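(* Let $K_{(1,n)}$ be the star with one central vertex and $n$ leaves. Over all index patterns $\mathscr{I}$ of $K_{(1,n)}$: (i) $$\min_{\mathscr{I}} mw(\mathbb{K}_{(1,n),\mathscr{I}})=\begin{cases}2\sum\limits_{i=1}^{\lceil\frac{n+1}{2}\rceil-1} i+\left\lceil\frac{n+1}{2}\right\rceil, & \text{if } n\ge 3 \text{ is odd},\\[2mm] 2\sum\limits_{i=1}^{\lceil\frac{n+1}{2}\rceil-1} i, & \text{if } n\ge 2\text{ is even}.\end{cases}$$ (ii) $$\max_{\mathscr{I}} mw(\mathbb{K}_{(1,n),\mathscr{I}})=\sum_{i=1}^{n} i\quad\text{for all } n\in\mathbb{N},\ n\ge 1.$$
   Context: An index pattern $\mathscr{I}$ of a graph on $N$ vertices is a bijective labelling of its vertices by $v_1,\dots,v_N$ (so the vertices carry the indices $1,\dots,N$; here $N=n+1$). The sprout graph of a graph $G$ with respect to $\mathscr{I}$ is the directed graph on $V(G)$ obtained by replacing every edge $v_iv_j$ of $G$ with $i<j$ by the arc $(v_i,v_j)$; $\mathbb{K}_{(1,n),\mathscr{I}}$ is the sprout graph of $K_{(1,n)}$. The weight of the arc $(v_i,v_j)$ is $j-i$, and the maturity weight $mw$ of a sprout graph is the sum of the weights of all its arcs. *)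

theory Defs
  imports Complex_Main "Graph_Theory.Kuratowski"
begin

text \<open>As in Graph_Theory, an undirected simple graph is a symmetric digraph (locale
  \<^locale>\<open>graph\<close>): the edge \<open>uv\<close> is present iff \<open>u \<rightarrow>\<^bsub>G\<^esub> v\<close>, equivalently \<open>v \<rightarrow>\<^bsub>G\<^esub> u\<close>. The star with one
  centre and \<open>n\<close> leaves is \<open>K\<^bsub>1,n\<^esub>\<close>. An index pattern is given by the function \<open>I\<close> sending each
  vertex to its index, so \<open>v\<^sub>i\<close> is the vertex \<open>v\<close> with \<open>I v = i\<close>; values of \<open>I\<close> outside the vertex set
  are irrelevant.\<close>

definition index_pattern :: "('a, 'b) pre_digraph \<Rightarrow> ('a \<Rightarrow> nat) \<Rightarrow> bool" where
  "index_pattern G I \<longleftrightarrow> bij_betw I (verts G) {1..card (verts G)}"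

definition sprout_graph :: "('a, 'b) pre_digraph \<Rightarrow> ('a \<Rightarrow> nat) \<Rightarrow> 'a pair_pre_digraph" where
  "sprout_graph G I = \<lparr> pverts = verts G, parcs = {(u, v). u \<rightarrow>\<^bsub>G\<^esub> v \<and> I u < I v} \<rparr>"

definition arc_weight :: "('a \<Rightarrow> nat) \<Rightarrow> 'a \<times> 'a \<Rightarrow> int" where
  "arc_weight I a = int (I (snd a)) - int (I (fst a))"

definition maturity_weight :: "('a \<Rightarrow> nat) \<Rightarrow> 'a pair_pre_digraph \<Rightarrow> int" where
  "maturity_weight I D = (\<Sum>a\<in>parcs D. arc_weight I a)"

definition sprout_weights :: "('a, 'b) pre_digraph \<Rightarrow> int set" where
  "sprout_weights G = {maturity_weight I (sprout_graph G I) | I. index_pattern G I}"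

text \<open>So \<open>Min\<close> and \<open>Max\<close> of \<open>sprout_weights G\<close> are meaningful:\<close>

lemma sprout_weights_finite_nonempty:
  assumes "graph G"
  shows "finite (sprout_weights G)" and "sprout_weights G \<noteq> {}"
proof -
  interpret graph G by fact
  let ?V = "verts G"
  let ?mw = "\<lambda>I. maturity_weight I (sprout_graph G I)"
  have restr: "?mw (restrict I ?V) = ?mw I" for I
  proof -
    have *: "u \<in> ?V" "v \<in> ?V" if "u \<rightarrow>\<^bsub>G\<^esub> v" for u v
      using that by (auto simp: arcs_ends_conv)
    have eq: "sprout_graph G (restrict I ?V) = sprout_graph G I"
      unfolding sprout_graph_def using * by (simp cong: conj_cong)
    show ?thesis
      unfolding maturity_weight_def eq
    proof (rule sum.cong[OF refl])
      fix a assume "a \<in> parcs (sprout_graph G I)"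
      then have "fst a \<rightarrow>\<^bsub>G\<^esub> snd a" by (cases a) (simp add: sprout_graph_def)
      from *[OF this] show "arc_weight (restrict I ?V) a = arc_weight I a"
        by (simp add: arc_weight_def)
    qed
  qed
  have "sprout_weights G \<subseteq> ?mw ` (?V \<rightarrow>\<^sub>E {1..card ?V})"
  proof
    fix w assume "w \<in> sprout_weights G"
    then obtain I where I: "index_pattern G I" "w = ?mw I"
      by (auto simp: sprout_weights_def)
    then have "restrict I ?V \<in> ?V \<rightarrow>\<^sub>E {1..card ?V}"
      by (simp add: index_pattern_def bij_betw_imp_funcset)
    moreover have "w = ?mw (restrict I ?V)"
      using I(2) restr[of I] by simp
    ultimately show "w \<in> ?mw ` (?V \<rightarrow>\<^sub>E {1..card ?V})"
      by blast
  qed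
  then show "finite (sprout_weights G)"
    by (rule finite_subset) (intro finite_imageI finite_PiE, simp_all)
  have "card ?V = card {1..card ?V}" by simp
  then obtain I where "bij_betw I ?V {1..card ?V}"
    using finite_same_card_bij[OF finite_verts] by blast
  then show "sprout_weights G \<noteq> {}"
    unfolding sprout_weights_def index_pattern_def by blast
qed

end

theory Submission
  imports Defs "HOL-Combinatorics.Transposition"
begin

text \<open>The weight of a sprout graph of the star depends only on the index \<open>k\<close> of the centre: it is
  the sum of the distances \<open>\<bar>j - k\<bar>\<close> over \<open>j = 1, \<dots>, n + 1\<close>, and every \<open>k\<close> occurs. With \<open>a = k - 1\<close>
  and \<open>b = n + 1 - k\<close> the doubled sum is \<open>a(a + 1) + b(b + 1)\<close>, where \<open>a + b = n\<close>; this is largest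
  for \<open>a = 0\<close> and smallest when \<open>a\<close> and \<open>b\<close> differ by at most one.\<close>

text \<open>Evaluates the sums of the theorem, which range over intervals of type
  \<open>int\<close>. Doubling avoids division.\<close>

lemma double_sum_int_interval:
  fixes m :: int
  assumes "0 \<le> m"
  shows "2 * (\<Sum>i = 1..m. i) = m * (m + 1)"
  using assms
proof (induction m rule: int_ge_induct)
  case (step m)
  have "{1..m + 1} = insert (m + 1) {1..m}" using step.hyps by auto
  then show ?case using step by (simp add: algebra_simps)
qed simp

text \<open>Induction starts at \<open>N = k\<close>, where all distances lie to the left of
  \<open>k\<close> and Gauss's formula applies. Each further index \<open>N + 1\<close> only adds
  the distance \<open>N + 1 - k\<close> on the right.\<close>

lemma double_sum_distances:
  fixes k N :: nat
  assumes "k \<le> N"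
  shows "2 * (\<Sum>j = 1..N. \<bar>int j - int k\<bar>)
    = int k * (int k - 1) + (int N - int k) * (int N - int k + 1)"
  using assms
proof (induction N rule: dec_induct)
  case base
  have "(\<Sum>j = 1..k. \<bar>int j - int k\<bar>) = (\<Sum>j = 1..k. int k - int j)"
    by (intro sum.cong) auto
  also have "2 * \<dots> = int k * (int k - 1)"
    using double_gauss_sum_from_Suc_0[where 'a = int, of k]
    by (simp add: sum_subtractf algebra_simps)
  finally show ?case by simp
next
  case (step N)
  then show ?case by (simp add: algebra_simps)
qed

text \<open>Each leaf lies on exactly one arc, directed towards the larger index, so this arc weighs
  the absolute difference of the two indices.\<close>

lemma maturity_weight_star:
  assumes verts: "verts G = insert c V" and "c \<notin> V"
    and ends: "arcs_ends G = {c} \<times> V \<union> V \<times> {c}"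
    and I: "index_pattern G I"
  shows "maturity_weight I (sprout_graph G I)
    = (\<Sum>j = 1..card (verts G). \<bar>int j - int (I c)\<bar>)"
proof -
  let ?arc = "\<lambda>v. if I v < I c then (v, c) else (c, v)"
  have bij: "bij_betw I (verts G) {1..card (verts G)}"
    using I by (simp add: index_pattern_def)
  have fin: "finite (verts G)"
    using bij bij_betw_finite by blast
  \<comment> \<open>Injectivity of \<open>I\<close> excludes ties, so the second branch of
    \<open>?arc\<close> is also a genuine arc.\<close>
  have neq: "I v \<noteq> I c" if "v \<in> V" for v
    using bij that \<open>c \<notin> V\<close> verts by (auto simp: bij_betw_def inj_on_def)
  have arcs: "parcs (sprout_graph G I) = ?arc ` V"
  proof
    show "parcs (sprout_graph G I) \<subseteq> ?arc ` V"
      by (auto simp: sprout_graph_def ends image_iff)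
    show "?arc ` V \<subseteq> parcs (sprout_graph G I)"
      using neq by (auto simp: sprout_graph_def ends linorder_neq_iff)
  qed
  \<comment> \<open>A leaf is recovered from its arc as the end other than \<open>c\<close>.\<close>
  have inj: "inj_on ?arc V"
    using \<open>c \<notin> V\<close> by (auto simp: inj_on_def split: if_splits)
  have "maturity_weight I (sprout_graph G I) = (\<Sum>v\<in>V. \<bar>int (I v) - int (I c)\<bar>)"
    unfolding maturity_weight_def arcs sum.reindex[OF inj]
    by (intro sum.cong) (auto simp: arc_weight_def)
  \<comment> \<open>The centre is at distance 0 from itself. Including it makes the sum range over
    all vertices, which \<open>I\<close> maps bijectively onto the indices.\<close>
  also have "\<dots> = (\<Sum>v\<in>verts G. \<bar>int (I v) - int (I c)\<bar>)"
    using fin \<open>c \<notin> V\<close> by (simp add: verts)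
  also have "\<dots> = (\<Sum>j = 1..card (verts G). \<bar>int j - int (I c)\<bar>)"
    by (rule sum.reindex_bij_betw[OF bij])
  finally show ?thesis .
qed

text \<open>Take any index pattern \<open>J\<close> and swap the indices \<open>J c\<close> and
  \<open>k\<close>.\<close>

lemma index_pattern_with_index:
  assumes "finite (verts G)" "c \<in> verts G" "k \<in> {1..card (verts G)}"
  obtains I where "index_pattern G I" "I c = k"
proof -
  have "card (verts G) = card {1..card (verts G)}" by simp
  then obtain J where J: "bij_betw J (verts G) {1..card (verts G)}"
    using finite_same_card_bij[OF assms(1)] by blast
  have "J c \<in> {1..card (verts G)}"
    using J assms(2) by (rule bij_betwE[rule_format])
  with assms(3) have "bij_betw (transpose (J c) k) {1..card (verts G)} {1..card (verts G)}"
    by (intro bij_betw_transpose_iff) blast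
  with J have "index_pattern G (transpose (J c) k \<circ> J)"
    unfolding index_pattern_def by (rule bij_betw_trans)
  then show thesis by (rule that) simp
qed

lemma sprout_weights_star:
  fixes G :: "('a, 'b) pre_digraph"
  assumes "K\<^bsub>1,n\<^esub> G"
  shows "sprout_weights G = (\<lambda>k. \<Sum>j = 1..Suc n. \<bar>int j - int k\<bar>) ` {1..Suc n}"
proof -
  interpret graph G
    using assms by (simp add: complete_bipartite_digraph_def)
  obtain U V where UV: "verts G = U \<union> V" "U \<inter> V = {}" "card U = 1" "card V = n"
    "arcs_ends G = U \<times> V \<union> V \<times> U"
    using assms unfolding complete_bipartite_digraph_def by blast
  obtain c where c: "U = {c}"
    using UV(3) card_1_singletonE by blast
  have star: "verts G = insert c V" "c \<notin> V" "arcs_ends G = {c} \<times> V \<union> V \<times> {c}"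
    using UV c by auto
  have card: "card (verts G) = Suc n"
    using star finite_verts UV(4) by simp
  note weight = maturity_weight_star[OF star, unfolded card]
  have index: "I c \<in> {1..Suc n}" if "index_pattern G I" for I
    using that star(1) unfolding index_pattern_def card by (auto simp: bij_betw_def)
  show ?thesis
  proof (intro equalityI subsetI)
    fix w assume "w \<in> sprout_weights G"
    then show "w \<in> (\<lambda>k. \<Sum>j = 1..Suc n. \<bar>int j - int k\<bar>) ` {1..Suc n}"
      using weight index by (auto simp: sprout_weights_def simp del: sum.cl_ivl_Suc)
  next
    fix w assume "w \<in> (\<lambda>k. \<Sum>j = 1..Suc n. \<bar>int j - int k\<bar>) ` {1..Suc n}"
    then obtain k where k: "k \<in> {1..Suc n}" "w = (\<Sum>j = 1..Suc n. \<bar>int j - int k\<bar>)"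
      by blast
    obtain I where I: "index_pattern G I" "I c = k"
      using index_pattern_with_index[OF finite_verts] star(1) k(1) unfolding card by blast
    show "w \<in> sprout_weights G"
      using weight[OF I(1)] I(1) unfolding sprout_weights_def k(2) I(2) by force
  qed
qed

theorem theorem4p9:
  fixes G :: "('a, 'b) pre_digraph" and n :: nat
  assumes "K\<^bsub>1,n\<^esub> G"
  shows "(odd n \<and> n \<ge> 3 \<longrightarrow>
            Min (sprout_weights G)
              = 2 * (\<Sum>i = 1..\<lceil>(real n + 1) / 2\<rceil> - 1. i) + \<lceil>(real n + 1) / 2\<rceil>)
       \<and> (even n \<and> n \<ge> 2 \<longrightarrow>
            Min (sprout_weights G) = 2 * (\<Sum>i = 1..\<lceil>(real n + 1) / 2\<rceil> - 1. i))
       \<and> (n \<ge> 1 \<longrightarrow> Max (sprout_weights G) = (\<Sum>i = 1..int n. i))"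
proof -
  define S where "S k = (\<Sum>j = 1..Suc n. \<bar>int j - int k\<bar>)" for k
  have weights: "sprout_weights G = S ` {1..Suc n}"
    unfolding S_def by (rule sprout_weights_star[OF assms])
  have S: "2 * S k = int k * (int k - 1) + (int n + 1 - int k) * (int n + 2 - int k)"
    if "k \<in> {1..Suc n}" for k
    using double_sum_distances[of k "Suc n"] that unfolding S_def
    by (simp add: algebra_simps del: sum.cl_ivl_Suc)
  \<comment> \<open>Doubled values are compared because the closed form is for
    \<open>2 * S k\<close>.\<close>
  have MinI: "Min (sprout_weights G) = S m"
    if "m \<in> {1..Suc n}" "\<And>k. k \<in> {1..Suc n} \<Longrightarrow> 2 * S m \<le> 2 * S k" for m
    unfolding weights using that by (intro Min_eqI) auto
  have MaxI: "Max (sprout_weights G) = S m"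
    if "m \<in> {1..Suc n}" "\<And>k. k \<in> {1..Suc n} \<Longrightarrow> 2 * S k \<le> 2 * S m" for m
    unfolding weights using that by (intro Max_eqI) auto
  have "Min (sprout_weights G)
      = 2 * (\<Sum>i = 1..\<lceil>(real n + 1) / 2\<rceil> - 1. i) + \<lceil>(real n + 1) / 2\<rceil>"
    if "odd n"
  proof -
    obtain h where n: "n = 2 * h + 1"
      using \<open>odd n\<close> by (rule oddE)
    have ceil: "\<lceil>(real n + 1) / 2\<rceil> = int h + 1"
      by (simp add: n ceiling_eq_iff)
    have mid: "2 * S (Suc h) = 2 * (int h + 1)\<^sup>2"
      using S[of "Suc h"] by (simp add: n algebra_simps power2_eq_square)
    have "Min (sprout_weights G) = S (Suc h)"
    proof (rule MinI)
      fix k assume k: "k \<in> {1..Suc n}"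
      \<comment> \<open>The indices run from 1 to \<open>2 * h + 2\<close>, with the two middle ones
        at \<open>d = 0\<close> and \<open>d = 1\<close>. The excess over the minimum is governed by
        \<open>d * (d - 1)\<close>, which is nonnegative since no integer lies strictly between 0
        and 1.\<close>
      define d where "d = int k - int h - 1"
      have kd: "int k = int h + 1 + d" by (simp add: d_def)
      have "2 * S k = 2 * (int h + 1)\<^sup>2 + 2 * (d * (d - 1))"
        unfolding S[OF k] kd by (simp add: n algebra_simps power2_eq_square)
      moreover have "0 \<le> d * (d - 1)"
        by (cases "d \<le> 0") (auto simp: mult_nonpos_nonpos)
      ultimately show "2 * S (Suc h) \<le> 2 * S k"
        using mid by simp
    qed (simp add: n)
    \<comment> \<open>The claimed value is \<open>h * (h + 1) + (h + 1)\<close>, that is, the square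
      of \<open>h + 1\<close>.\<close>
    then show ?thesis
      using mid double_sum_int_interval[of "int h"]
      unfolding ceil by (simp add: power2_eq_square algebra_simps)
  qed
  moreover have "Min (sprout_weights G) = 2 * (\<Sum>i = 1..\<lceil>(real n + 1) / 2\<rceil> - 1. i)"
    if "even n"
  proof -
    obtain h where n: "n = 2 * h"
      using \<open>even n\<close> by (rule evenE)
    have ceil: "\<lceil>(real n + 1) / 2\<rceil> = int h + 1"
      by (simp add: n ceiling_eq_iff)
    have mid: "2 * S (Suc h) = 2 * (int h * (int h + 1))"
      using S[of "Suc h"] by (simp add: n algebra_simps)
    have "Min (sprout_weights G) = S (Suc h)"
    proof (rule MinI)
      fix k assume k: "k \<in> {1..Suc n}"
      \<comment> \<open>Here \<open>h + 1\<close> is the only middle index of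
        \<open>1, ..., 2 * h + 1\<close>, and moving the centre by \<open>d\<close> costs exactly
        the square of \<open>d\<close>.\<close>
      define d where "d = int k - int h - 1"
      have kd: "int k = int h + 1 + d" by (simp add: d_def)
      have "2 * S k = 2 * (int h * (int h + 1)) + 2 * d\<^sup>2"
        unfolding S[OF k] kd by (simp add: n algebra_simps power2_eq_square)
      then show "2 * S (Suc h) \<le> 2 * S k"
        using mid by simp
    qed (simp add: n)
    then show ?thesis
      using mid double_sum_int_interval[of "int h"] by (simp add: ceil)
  qed
  moreover have "Max (sprout_weights G) = (\<Sum>i = 1..int n. i)"
  proof -
    have first: "2 * S 1 = int n * (int n + 1)"
      using S[of 1] by simp
    have "Max (sprout_weights G) = S 1"
    proof (rule MaxI)
      fix k assume k: "k \<in> {1..Suc n}"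
      \<comment> \<open>With \<open>a + b = n\<close>, the deficit n(n + 1) - a(a + 1) - b(b + 1)
        equals 2ab. It vanishes exactly when the centre has the first or the last index.\<close>
      have "int n * (int n + 1) - 2 * S k = 2 * ((int k - 1) * (int n + 1 - int k))"
        unfolding S[OF k] by (simp add: algebra_simps)
      moreover have "0 \<le> (int k - 1) * (int n + 1 - int k)"
        using k by (intro mult_nonneg_nonneg) auto
      ultimately show "2 * S k \<le> 2 * S 1"
        using first by linarith
    qed simp
    then show ?thesis
      using first double_sum_int_interval[of "int n"] by simp
  qed
  ultimately show ?thesis by blast
qed

end
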